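(* Let $Y$ be the affine curve (of genus 5) over $\mathbb{Q}$ in coordinates $(x,y,z)$ defined by \[ y^2 = (5x^2-1)(x^2+3), \qquad z^2 = -(3x^2+1)(x^2-5). \] Then $Y(\mathbb{Q},2) = Y(\mathbb{Q}) = \{(\pm1,\pm4,\pm4)\}$.
   Context: For a curve $X$ defined over $\mathbb{Q}$, $X(\mathbb{Q},2)$ denotes the set of points $P \in X(\overline{\mathbb{Q}})$ with $[\mathbb{Q}(P):\mathbb{Q}] \le 2$. Sign choices are independent. *)

theory Defs
  imports Complex_Main "HOL-Computational_Algebra.Computational_Algebra" "HOL-Algebra.Algebra"
    "HOL-Algebra.Algebraic_Closure_Type"
begin

abbreviation complex_field :: "complex ring" where
  "complex_field \<equiv> ring_of_type_algebra"

(* The algebraic closure of the rationals is realised inside the complex numbers. *)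
abbreviation Qbar :: "complex set" where
  "Qbar \<equiv> {a. Polynomial.algebraic a}"

(* The points of the affine curve Y with coordinates in a field K between Q and Qbar. *)
definition Y :: "complex set \<Rightarrow> (complex \<times> complex \<times> complex) set" where
  "Y K = {(x, y, z). x \<in> K \<and> y \<in> K \<and> z \<in> K \<and>
     y ^ 2 = (5 * x ^ 2 - 1) * (x ^ 2 + 3) \<and>
     z ^ 2 = - (3 * x ^ 2 + 1) * (x ^ 2 - 5)}"

(* The field Q(P).  A subfield generated in characteristic 0 contains Q automatically. *)
fun point_field :: "complex \<times> complex \<times> complex \<Rightarrow> complex set" where
  "point_field (x, y, z) = generate_field complex_field {x, y, z}"

(* [Q(P):Q] \<le> d.  Finiteness is required separately because ring.dim is a definite
   description, with unspecified value on infinite-dimensional spaces. *)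
definition degree_at_most :: "nat \<Rightarrow> complex \<times> complex \<times> complex \<Rightarrow> bool" where
  "degree_at_most d P \<longleftrightarrow>
     ring.finite_dimension complex_field \<rat> (point_field P) \<and>
     ring.dim complex_field \<rat> (point_field P) \<le> d"

definition Y_deg :: "nat \<Rightarrow> (complex \<times> complex \<times> complex) set" where
  "Y_deg d = {P \<in> Y Qbar. degree_at_most d P}"

end

theory Submission
  imports Defs
begin

text \<open>
  Let \<open>K\<close> have degree at most 2 over the rationals and put \<open>\<xi> = x\<^sup>2\<close>.  The products \<open>xy\<close> and \<open>yz\<close>
  lie on the elliptic curves \<open>v\<^sup>2 = \<xi>(5\<xi> - 1)(\<xi> + 3)\<close> and \<open>w\<^sup>2 = -(5\<xi> - 1)(\<xi> + 3)(3\<xi> + 1)(\<xi> - 5)\<close>,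
  and \<open>xz\<close> on the image of the first one under \<open>\<xi> \<mapsto> 1 / \<xi>\<close>.  Both have finitely many rational
  points: they map to \<open>s\<^sup>2 = (r\<^sup>2 - 1)(r\<^sup>2 - k\<^sup>2)\<close> with \<open>k = 9\<close> and \<open>k = 3\<close> respectively, and an
  infinite descent shows that this curve has only trivial points.

  If \<open>\<xi>\<close> is irrational, the line through \<open>(\<xi>, xy)\<close> and its conjugate meets the first elliptic curve
  in a third, rational point.  Since the norm \<open>n\<^sup>2\<close> of \<open>\<xi>\<close> is a square, this point has to be
  \<open>(1/5, 0)\<close>, so that \<open>\<xi>\<close> has trace \<open>5n\<^sup>2 - 3\<close>.  The automorphism \<open>x \<mapsto> 1 / x\<close> gives the trace
  \<open>5 - 3n\<^sup>2\<close> as well; hence \<open>\<xi>\<^sup>2 - 2\<xi> + 1 = 0\<close>, which is impossible.  If \<open>\<xi>\<close> is rational, then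
  \<open>x\<close>, \<open>y\<close>, \<open>z\<close> are square roots of rationals in a quadratic field, so one of \<open>xy\<close>, \<open>xz\<close>, \<open>yz\<close> is
  rational and \<open>\<xi>\<close> belongs to a finite list.
\<close>

subsection \<open>Infinite descent\<close>

text \<open>After division by the gcd the cofactors are coprime with a square product, so unique
  factorisation makes each a square.\<close>

lemma mult_eq_square_int:
  fixes x y s :: int
  assumes "x > 0" "y > 0" "x * y = s ^ 2"
  obtains a b where "a > 0" "b > 0" "coprime a b" "x = gcd x y * a ^ 2" "y = gcd x y * b ^ 2"
proof -
  define g where "g = gcd x y"
  have g: "g > 0" using assms by (simp add: g_def)
  define u v where "u = x div g" and "v = y div g"
  have x: "x = g * u" and y: "y = g * v" by (auto simp: u_def v_def g_def)
  have uv: "coprime u v" using assms(1) unfolding u_def v_def g_def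
    by (intro div_gcd_coprime) auto
  have pos: "u > 0" "v > 0" using assms g x y by (auto simp: zero_less_mult_iff)
  have s: "g ^ 2 * (u * v) = s ^ 2" using assms(3) unfolding x y by (simp add: power2_eq_square algebra_simps)
  then have "g ^ 2 dvd s ^ 2" by (metis dvd_triv_left)
  then have "g dvd s" by simp
  then obtain w where "s = g * w" by blast
  then have "u * v = w ^ 2" using s g by (simp add: power_mult_distrib)
  then have "nat u * nat v = nat \<bar>w\<bar> ^ 2" using pos
    by (metis nat_mult_distrib less_imp_le nat_power_eq abs_ge_zero power2_abs)
  moreover have "coprime (nat u) (nat v)" using uv pos
    by (metis coprime_int_iff nat_0_le less_imp_le)
  ultimately have "is_square (nat u)" "is_square (nat v)"
    using is_nth_power_mult_coprime_natD[of "nat u" "nat v" 2] pos by auto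
  then obtain a b where ab: "nat u = a ^ 2" "nat v = b ^ 2" by (auto elim!: is_nth_powerE)
  have u: "u = int a ^ 2" and v: "v = int b ^ 2" using ab pos
    by (metis int_nat_eq less_imp_le of_nat_power)+
  show thesis
  proof (rule that[of "int a" "int b"])
    show "int a > 0" "int b > 0" using u v pos by auto
    show "coprime (int a) (int b)" using uv unfolding u v by simp
    show "x = gcd x y * int a ^ 2" "y = gcd x y * int b ^ 2"
      unfolding u[symmetric] v[symmetric] g_def[symmetric] by (fact x, fact y)
  qed
qed

text \<open>Factor \<open>Q ^ 2\<close> as \<open>(P + \<bar>U\<bar>) * (P - \<bar>U\<bar>)\<close>
  and write the factors as \<open>e * m ^ 2\<close> and \<open>e * n ^ 2\<close>. Their gcd
  \<open>e\<close> divides \<open>2 * P\<close> and \<open>2 * Q\<close>, hence 2. Keeping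
  \<open>e\<close> treats both parities of \<open>Q\<close> at once.\<close>

lemma Pythagorean_param:
  fixes P Q U :: int
  assumes "coprime P Q" "P > 0" "Q > 0" "P ^ 2 - Q ^ 2 = U ^ 2"
  obtains e m n where "m > 0" "n > 0" "coprime m n" "e = (if even Q then 2 else 1)"
    "Q = e * (m * n)" "2 * P = e * (m ^ 2 + n ^ 2)"
proof -
  define x y where "x = P + \<bar>U\<bar>" and "y = P - \<bar>U\<bar>"
  have xy: "x * y = Q ^ 2" using assms(4) unfolding x_def y_def
    by (simp add: algebra_simps power2_eq_square)
  have "x > 0" using assms x_def by simp
  moreover have "y > 0" using xy assms(3) \<open>x > 0\<close> by (metis zero_less_mult_pos zero_less_power)
  ultimately obtain m n where mn: "m > 0" "n > 0" "coprime m n" "x = gcd x y * m ^ 2" "y = gcd x y * n ^ 2"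
    using mult_eq_square_int xy by metis
  define e where "e = gcd x y"
  have e0: "e > 0" using \<open>x > 0\<close> by (simp add: e_def)
  have xe: "x = e * m ^ 2" and ye: "y = e * n ^ 2" using mn unfolding e_def by blast+
  have "2 * P = x + y" by (simp add: x_def y_def)
  then have P: "2 * P = e * (m ^ 2 + n ^ 2)" unfolding xe ye by (simp add: algebra_simps)
  have "Q ^ 2 = (e * (m * n)) ^ 2" using xy unfolding xe ye by (simp add: power2_eq_square algebra_simps)
  then have Q: "Q = e * (m * n)" using assms(3) e0 mn by (simp add: power2_eq_iff_nonneg)
  have "e dvd 2 * P" "e dvd 2 * Q" using P Q by auto
  then have "e dvd gcd (2 * P) (2 * Q)" by simp
  also have "gcd (2 * P) (2 * Q) = 2" using assms(1) by (simp add: gcd_mult_left coprime_iff_gcd_eq_1)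
  finally have e12: "e = 1 \<or> e = 2" using e0 zdvd_imp_le[of e 2] by auto
  \<comment> \<open>For \<open>e = 1\<close> the sum \<open>m ^ 2 + n ^ 2 = 2 * P\<close> is even,
    so the coprime \<open>m\<close> and \<open>n\<close> are both odd.\<close>
  have "odd Q" if "e = 1"
  proof -
    have "even (m ^ 2 + n ^ 2)" using P that by (metis dvd_triv_left mult_1)
    then have "even m \<longleftrightarrow> even n" by simp
    then have "odd m" "odd n" using mn(3) by (metis coprime_common_divisor odd_one)+
    then show ?thesis using Q that by simp
  qed
  then have "e = (if even Q then 2 else 1)" using e12 Q by auto
  then show thesis using that mn Q P by blast
qed

text \<open>Two factorisations of one number have a common refinement, found from
  \<open>a = gcd m s\<close>.\<close>

lemma four_number_lemma:
  fixes m n s t :: int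
  assumes "m > 0" "n > 0" "s > 0" "t > 0" "coprime m n" "m * n = s * t"
  obtains a b c d where "a > 0" "b > 0" "c > 0" "d > 0" "m = a * b" "n = c * d" "s = a * c" "t = b * d"
    "coprime b c" "coprime a d"
proof -
  define a where "a = gcd m s"
  define b c where "b = m div a" and "c = s div a"
  have a: "a > 0" using assms by (simp add: a_def)
  have m: "m = a * b" and s: "s = a * c" by (auto simp: a_def b_def c_def)
  have bc: "coprime b c" using assms(1) unfolding a_def b_def c_def by (intro div_gcd_coprime) auto
  have eq: "b * n = c * t" using assms(6) a unfolding m s by simp
  have "b > 0" "c > 0" using a assms m s by (auto simp: zero_less_mult_iff)
  from eq have "b dvd c * t" by (metis dvd_triv_left)
  then have "b dvd t" using bc by (simp add: coprime_dvd_mult_right_iff)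
  then obtain d where t: "t = b * d" by blast
  then have n: "n = c * d" using eq \<open>b > 0\<close> by simp
  have "d > 0" using t assms \<open>b > 0\<close> by (simp add: zero_less_mult_iff)
  moreover have "coprime a d" using assms(5) m n by auto
  ultimately show thesis using that a \<open>b > 0\<close> \<open>c > 0\<close> m n s t bc by blast
qed

section \<open>Descent on two simultaneous squares\<close>

lemma mod3_cases: "x mod 3 = 0 \<or> x mod 3 = 1 \<or> x mod 3 = 2" for x :: int
  by presburger

text \<open>The hypotheses are two Pythagorean triples with the same hypotenuse \<open>P\<close> and
  legs \<open>Q\<close> and \<open>k * Q\<close>. Comparing parameters gives
  \<open>m ^ 2 + n ^ 2 = s ^ 2 + t ^ 2\<close> and \<open>s * t = k * (m * n)\<close>. Refining the
  factorisations turns this into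
  \<open>a ^ 2 * (b ^ 2 - k ^ 2 * c ^ 2) = d ^ 2 * (b ^ 2 - c ^ 2)\<close> with \<open>a\<close> and
  \<open>d\<close> coprime, so the brackets are \<open>d ^ 2 * h\<close> and
  \<open>a ^ 2 * h\<close>.\<close>

lemma descent_step_coprime:
  fixes P Q U V k :: int
  assumes k: "k = 3 ^ j" "j > 0"
    and PQ: "coprime P Q" "P > 0" "Q > 0" "P ^ 2 - Q ^ 2 = U ^ 2" "P ^ 2 - k ^ 2 * Q ^ 2 = V ^ 2"
  obtains b c w where "b > 0" "c > 0" "coprime b c" "b * c \<le> Q" "w \<noteq> 0"
    "(b ^ 2 - c ^ 2) * (b ^ 2 - k ^ 2 * c ^ 2) = w ^ 2"
proof -
  note result = that
  have "k > 0" "odd k" using k by auto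
  \<comment> \<open>Since -1 is not a square modulo 3, \<open>3 dvd Q ^ 2 + U ^ 2\<close> would
    force \<open>3 dvd Q\<close>. This makes \<open>P\<close> coprime to \<open>k * Q\<close>, as
    the second triple requires.\<close>
  have "\<not> 3 dvd P"
  proof
    assume "3 dvd P"
    then obtain P' where P': "P = 3 * P'" by blast
    have "Q ^ 2 + U ^ 2 = 3 * (3 * P' ^ 2)" using PQ(4) P' by (simp add: power_mult_distrib)
    then have *: "(Q ^ 2 + U ^ 2) mod 3 = 0" by simp
    have aux: "(q ^ 2 + u ^ 2) mod 3 \<noteq> 0" if "q = 1 \<or> q = 2" "u = 0 \<or> u = 1 \<or> u = 2" for q u :: int
      using that by auto
    have "((Q mod 3) ^ 2 + (U mod 3) ^ 2) mod 3 = 0"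
      using * mod_add_eq[of "(Q mod 3) ^ 2" 3 "(U mod 3) ^ 2"] mod_add_eq[of "Q ^ 2" 3 "U ^ 2"]
      by (simp only: power_mod)
    then have "\<not> (Q mod 3 = 1 \<or> Q mod 3 = 2)"
      using aux[of "Q mod 3" "U mod 3"] by (metis mod3_cases)
    then have "Q mod 3 = 0" using mod3_cases by blast
    then have "3 dvd Q" by presburger
    then show False using \<open>3 dvd P\<close> PQ(1) coprime_common_divisor[of P Q 3] by simp
  qed
  moreover have p3: "Factorial_Ring.prime (3 :: int)" by simp
  ultimately have "coprime P 3" by (metis coprime_commute prime_imp_coprime)
  then have co: "coprime P (k * Q)" using PQ(1) k by simp
  obtain e m n where mn: "m > 0" "n > 0" "coprime m n" "e = (if even Q then 2 else 1)"
    "Q = e * (m * n)" "2 * P = e * (m ^ 2 + n ^ 2)"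
    using Pythagorean_param[OF PQ(1-4)] by metis
  have "P ^ 2 - (k * Q) ^ 2 = V ^ 2" using PQ(5) by (simp add: power_mult_distrib)
  then obtain e' s t where st: "s > 0" "t > 0" "coprime s t" "e' = (if even (k * Q) then 2 else 1)"
    "k * Q = e' * (s * t)" "2 * P = e' * (s ^ 2 + t ^ 2)"
    using Pythagorean_param[OF co PQ(2)] PQ(3) \<open>k > 0\<close> by (metis zero_less_mult_iff)
  have "e' = e" using mn(4) st(4) \<open>odd k\<close> by simp
  moreover have "e \<noteq> 0" using mn(4) by auto
  moreover have "e * (m ^ 2 + n ^ 2) = e' * (s ^ 2 + t ^ 2)" by (rule trans[OF mn(6)[symmetric] st(6)])
  moreover have "e' * (s * t) = e * (k * (m * n))" unfolding st(5)[symmetric] by (subst mn(5)) simp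
  ultimately have sum: "m ^ 2 + n ^ 2 = s ^ 2 + t ^ 2" and prod: "s * t = k * (m * n)"
    by simp_all
  \<comment> \<open>The coprime \<open>s\<close> and \<open>t\<close> play symmetric roles and 3
    misses one of them; calling that one \<open>t\<close> puts all of \<open>k\<close> into
    \<open>s\<close>.\<close>
  have main: thesis if st: "s > 0" "t > 0" "m ^ 2 + n ^ 2 = s ^ 2 + t ^ 2" "s * t = k * (m * n)"
    "\<not> 3 dvd t" for s t
  proof -
    have "coprime t k" using that(5) p3 k by (metis coprime_commute prime_imp_coprime coprime_power_right_iff)
    moreover have "k dvd s * t" using that(4) by simp
    ultimately have "k dvd s" by (simp add: coprime_dvd_mult_left_iff coprime_commute)
    then obtain s' where s': "s = k * s'" by blast
    have "s' > 0" using s' \<open>k > 0\<close> st by (simp add: zero_less_mult_iff)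
    have "m * n = s' * t" using that(4) s' \<open>k > 0\<close> by simp
    then obtain a b c d where abcd: "a > 0" "b > 0" "c > 0" "d > 0" "m = a * b" "n = c * d" "s' = a * c"
      "t = b * d" "coprime b c" "coprime a d"
      using four_number_lemma[OF mn(1,2) \<open>s' > 0\<close> st(2) mn(3)] by metis
    have eq: "a ^ 2 * (b ^ 2 - k ^ 2 * c ^ 2) = d ^ 2 * (b ^ 2 - c ^ 2)"
      using that(3) unfolding s' abcd(5-8) by (simp add: power_mult_distrib algebra_simps)
    then have "d ^ 2 dvd a ^ 2 * (b ^ 2 - k ^ 2 * c ^ 2)" by simp
    moreover have "coprime (d ^ 2) (a ^ 2)" using abcd(10) by (simp add: coprime_commute)
    ultimately have "d ^ 2 dvd b ^ 2 - k ^ 2 * c ^ 2" by (simp add: coprime_dvd_mult_right_iff)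
    then obtain h where h: "b ^ 2 - k ^ 2 * c ^ 2 = d ^ 2 * h" by blast
    then have h': "b ^ 2 - c ^ 2 = a ^ 2 * h" using eq abcd(4) by simp
    have "h \<noteq> 0"
    proof
      assume "h = 0"
      then have "(k ^ 2 - 1) * c ^ 2 = 0" using h h' by (simp add: algebra_simps)
      then have "k ^ 2 = 1" using abcd(3) by simp
      then have "k = 1" using \<open>k > 0\<close> by (simp add: power2_eq_1_iff)
      then show False using k by simp
    qed
    show thesis
    proof (rule result)
      show "(b ^ 2 - c ^ 2) * (b ^ 2 - k ^ 2 * c ^ 2) = (a * d * h) ^ 2"
        unfolding h h' by (simp add: power2_eq_square)
      show "a * d * h \<noteq> 0" using abcd \<open>h \<noteq> 0\<close> by simp
      have "1 * (b * c) \<le> (e * a * d) * (b * c)" using abcd mn(4)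
        by (intro mult_right_mono) (auto simp: int_one_le_iff_zero_less zero_less_mult_iff)
      then show "b * c \<le> Q" using mn(5) abcd by (simp add: algebra_simps)
    qed (use abcd in auto)
  qed
  show thesis
  proof (cases "3 dvd t")
    case False
    then show ?thesis using main st sum prod by blast
  next
    case True
    then have "\<not> 3 dvd s" using st(3) coprime_common_divisor[of s t 3] by auto
    then show ?thesis using main[of t s] st sum prod by (simp add: algebra_simps)
  qed
qed

text \<open>Everything is divided by \<open>gcd P Q\<close>, because the pairs to which the descent
  is applied below are not all known to be coprime.\<close>

lemma descent_step:
  fixes P Q U V k :: int
  assumes k: "k = 3 ^ j" "j > 0"
    and PQ: "P > 0" "Q > 0" "P ^ 2 - Q ^ 2 = U ^ 2" "P ^ 2 - k ^ 2 * Q ^ 2 = V ^ 2"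
  obtains b c w where "b > 0" "c > 0" "coprime b c" "b * c \<le> Q" "w \<noteq> 0"
    "(b ^ 2 - c ^ 2) * (b ^ 2 - k ^ 2 * c ^ 2) = w ^ 2"
proof -
  define g where "g = gcd P Q"
  define P' Q' where "P' = P div g" and "Q' = Q div g"
  have g: "g > 0" using PQ by (simp add: g_def)
  have P: "P = g * P'" and Q: "Q = g * Q'" by (auto simp: P'_def Q'_def g_def)
  have co: "coprime P' Q'" using PQ(1) unfolding P'_def Q'_def g_def by (intro div_gcd_coprime) auto
  have pos: "P' > 0" "Q' > 0" using g PQ P Q by (auto simp: zero_less_mult_iff)
  have U: "U ^ 2 = g ^ 2 * (P' ^ 2 - Q' ^ 2)" using PQ(3) unfolding P Q by (simp add: algebra_simps)
  then have "g ^ 2 dvd U ^ 2" by simp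
  then have "g dvd U" by simp
  then obtain U' where U': "U = g * U'" by blast
  have V: "V ^ 2 = g ^ 2 * (P' ^ 2 - k ^ 2 * Q' ^ 2)" using PQ(4) unfolding P Q by (simp add: algebra_simps)
  then have "g ^ 2 dvd V ^ 2" by simp
  then have "g dvd V" by simp
  then obtain V' where V': "V = g * V'" by blast
  have "P' ^ 2 - Q' ^ 2 = U' ^ 2" "P' ^ 2 - k ^ 2 * Q' ^ 2 = V' ^ 2"
    using U V g unfolding U' V' by (auto simp: power_mult_distrib)
  then obtain b c w where bcw: "b > 0" "c > 0" "coprime b c" "b * c \<le> Q'" "w \<noteq> 0"
    "(b ^ 2 - c ^ 2) * (b ^ 2 - k ^ 2 * c ^ 2) = w ^ 2"
    using descent_step_coprime[OF k co pos] by metis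
  moreover have "Q' \<le> Q" using g pos Q mult_right_mono[of 1 g Q'] by simp
  ultimately show thesis using that by fastforce
qed

lemma odd_square_mod_8:
  fixes x :: int
  assumes "odd x"
  shows "x ^ 2 mod 8 = 1"
proof -
  obtain c where c: "x = 2 * c + 1" using assms by (rule oddE)
  have "even (c * (c + 1))" by simp
  then obtain d where "c * (c + 1) = 2 * d" by (rule evenE)
  then have "x ^ 2 = 8 * d + 1" unfolding c by (simp add: power2_eq_square algebra_simps)
  then show ?thesis by simp
qed

text \<open>Congruences modulo 8 exclude the \<open>g\<close> for which neither \<open>g\<close> nor \<open>(k\<^sup>2 - 1) / g\<close> is a square (they
  occur for \<open>k = 9\<close> only).  The second alternative belongs to points that become divisible by 2
  after adding a 2-torsion point.\<close>

lemma good_gcd: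
  fixes k g A B p q :: int
  assumes k: "k = 3 \<or> k = 9" and g: "g > 0" "g dvd k ^ 2 - 1" and co: "coprime A B" "coprime p q"
    and eq: "\<bar>p ^ 2 - q ^ 2\<bar> = g * A ^ 2" "\<bar>g * (A ^ 2 - B ^ 2)\<bar> = (k ^ 2 - 1) * q ^ 2"
  obtains f where "f > 0" "g = f ^ 2" | f where "f > 0" "k ^ 2 - 1 = g * f ^ 2"
proof -
  have cases3: "g = 1 \<or> g = 2 \<or> g = 4 \<or> g = 8" if "k = 3"
  proof -
    have "g dvd 8" using g(2) that by simp
    moreover have "g \<in> {1..8}" using g zdvd_imp_le[OF \<open>g dvd 8\<close>] by simp
    moreover have "{1..8} = {1, 2, 3, 4, 5, 6, 7, 8 :: int}" by auto
    ultimately show ?thesis by auto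
  qed
  have cases9: "g \<in> {1, 2, 4, 5, 8, 10, 16, 20, 40, 80}" if "k = 9"
  proof -
    have "g dvd 80" using g(2) that by simp
    then obtain h where h: "80 = g * h" by blast
    have "h > 0" using h g(1) by (metis zero_less_mult_pos zero_less_numeral)
    \<comment> \<open>One of the two complementary divisors of 80 is small, which leaves finitely
      many cases to check.\<close>
    have "g \<le> 8 \<or> h \<le> 9"
    proof (rule ccontr)
      assume "\<not> ?thesis"
      then have "9 * 10 \<le> g * h" by (intro mult_mono) auto
      then show False using h by simp
    qed
    then have "g = 1 \<or> g = 2 \<or> g = 3 \<or> g = 4 \<or> g = 5 \<or> g = 6 \<or> g = 7 \<or> g = 8 \<or>
      h = 1 \<or> h = 2 \<or> h = 3 \<or> h = 4 \<or> h = 5 \<or> h = 6 \<or> h = 7 \<or> h = 8 \<or> h = 9"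
      using g(1) \<open>h > 0\<close> by presburger
    then have "g = 1 \<or> g = 2 \<or> g = 4 \<or> g = 5 \<or> g = 8 \<or> g = 10 \<or> g = 16 \<or> g = 20 \<or> g = 40 \<or> g = 80"
      using h by (elim disjE; hypsubst; presburger)
    then show ?thesis by simp
  qed
  \<comment> \<open>Even \<open>g\<close> makes \<open>p\<close> and \<open>q\<close> odd. For
    \<open>g\<close> equal to 2 or 10, both \<open>A\<close> and \<open>B\<close> become even; for 8
    or 40, \<open>A ^ 2 - B ^ 2\<close> would be 2 modulo 4, which no difference of squares
    is.\<close>
  have False if k9: "k = 9" and gs: "g \<in> {2, 8, 10, 40}"
  proof -
    have "even g" using gs by auto
    then have "even (p ^ 2 - q ^ 2)" using eq(1) by (metis dvd_mult2 dvd_abs_iff)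
    then have "even p \<longleftrightarrow> even q" by simp
    then have odd: "odd p" "odd q" using co(2) by (metis coprime_common_divisor odd_one)+
    have q2: "q ^ 2 mod 8 = 1" and p2: "p ^ 2 mod 8 = 1"
      using odd odd_square_mod_8 by blast+
    then have d8: "8 dvd g * A ^ 2" unfolding eq(1)[symmetric] dvd_abs_iff using p2 q2 by (metis mod_eq_dvd_iff)
    have e: "g * (A ^ 2 - B ^ 2) = 80 * q ^ 2 \<or> g * (A ^ 2 - B ^ 2) = - (80 * q ^ 2)"
      using eq(2) k9 by (auto simp: abs_if split: if_splits)
    have small: "even z \<and> even w" if "g = 2 \<or> g = 10" "8 dvd g * z" "g * w = 80 * u \<or> g * w = - (80 * u)" for z w u :: int
      using that(1) that(2,3) by (elim disjE[of "g = 2"]; simp only:; presburger)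
    have large: "w mod 4 = 2" if "g = 8 \<or> g = 40" "odd u" "g * w = 80 * u \<or> g * w = - (80 * u)" for w u :: int
    proof -
      have "w = 10 * u \<or> w = - 10 * u \<or> w = 2 * u \<or> w = - 2 * u" using that(1,3) by auto
      then show ?thesis using \<open>odd u\<close> by (elim disjE; hypsubst; presburger)
    qed
    have parity: "even A \<longleftrightarrow> even B" if "even (A ^ 2 - B ^ 2)" using that by simp
    consider "g = 2 \<or> g = 10" | "g = 8 \<or> g = 40" using gs by blast
    then show False
    proof cases
      case 1
      then have "even (A ^ 2)" "even (A ^ 2 - B ^ 2)" using small[OF 1 d8 e] by blast+
      then show False using parity co(1) by (metis coprime_common_divisor odd_one even_power)
    next
      case 2
      then have e': "(A ^ 2 - B ^ 2) mod 4 = 2" using large[OF 2 _ e] odd by simp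
      then have "even (A ^ 2 - B ^ 2)" by presburger
      then have "even A \<longleftrightarrow> even B" by simp
      then have "even (A - B)" by simp
      then obtain c where "A - B = 2 * c" by (rule evenE)
      then have Ac: "A = B + 2 * c" by simp
      have "A ^ 2 - B ^ 2 = 4 * (c * (B + c))" unfolding Ac by (simp add: power2_eq_square algebra_simps)
      then show False using e' by simp
    qed
  qed
  then have "g \<in> {1, 2, 4, 8} \<and> k = 3 \<or> g \<in> {1, 4, 16, 5, 20, 80} \<and> k = 9"
    using cases3 cases9 k by blast
  then show thesis using that(1)[of 1] that(1)[of 2] that(1)[of 4] that(2)[of 1] that(2)[of 2] that(2)[of 4]
    by auto
qed

text \<open>Strong induction on \<open>p * q\<close>. Up to sign the two factors are
  \<open>g * A ^ 2\<close> and \<open>g * B ^ 2\<close>. In each of the four cases given by the sign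
  and by \<open>good_gcd\<close> there are \<open>P\<close> and \<open>Q < p * q\<close> to which
  the descent step applies; it returns a smaller solution with nonzero right-hand side.\<close>

lemma square_mult_no_solution:
  fixes k p q s :: int
  assumes k: "k = 3 \<or> k = 9" and pos: "p > 0" "q > 0" and co: "coprime p q"
    and eq: "(p ^ 2 - q ^ 2) * (p ^ 2 - k ^ 2 * q ^ 2) = s ^ 2"
  shows "s = 0"
  using pos co eq
proof (induction "nat (p * q)" arbitrary: p q s rule: less_induct)
  case less
  show "s = 0"
  proof (rule ccontr)
    assume "s \<noteq> 0"
    obtain j :: nat where j: "k = 3 ^ j" "j > 0"
      using k that[of 1] that[of 2] by auto
    have descent: False if PQ: "P > 0" "Q > 0" "P ^ 2 - Q ^ 2 = U ^ 2" "P ^ 2 - k ^ 2 * Q ^ 2 = V ^ 2" "Q < p * q"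
      for P Q U V
    proof -
      obtain b c w where "b > 0" "c > 0" "coprime b c" "b * c \<le> Q" "w \<noteq> 0"
        "(b ^ 2 - c ^ 2) * (b ^ 2 - k ^ 2 * c ^ 2) = w ^ 2"
        using descent_step[OF j PQ(1-4)] by metis
      then show False using less(1)[of b c w] PQ by (smt (verit) mult_pos_pos nat_less_eq_zless)
    qed
    define x y where "x = p ^ 2 - q ^ 2" and "y = p ^ 2 - k ^ 2 * q ^ 2"
    have xy: "x * y = s ^ 2" using less.prems(4) by (simp add: x_def y_def)
    moreover have "s ^ 2 > 0" using \<open>s \<noteq> 0\<close> by simp
    ultimately have "x * y > 0" by simp
    then have signs: "x > 0 \<and> y > 0 \<or> - x > 0 \<and> - y > 0" by (auto simp: zero_less_mult_iff)
    have "\<bar>x\<bar> > 0" "\<bar>y\<bar> > 0" "\<bar>x\<bar> * \<bar>y\<bar> = s ^ 2" using signs xy by auto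
    then obtain A B where AB: "A > 0" "B > 0" "coprime A B" "\<bar>x\<bar> = gcd \<bar>x\<bar> \<bar>y\<bar> * A ^ 2"
      "\<bar>y\<bar> = gcd \<bar>x\<bar> \<bar>y\<bar> * B ^ 2"
      by (rule mult_eq_square_int)
    define g where "g = gcd x y"
    have g: "\<bar>x\<bar> = g * A ^ 2" "\<bar>y\<bar> = g * B ^ 2" "g > 0" 
      using AB(4,5) signs unfolding gcd_abs1_int gcd_abs2_int g_def[symmetric] by (simp, simp, auto simp: g_def)
    \<comment> \<open>The first combination eliminates \<open>p\<close>, the second
      \<open>q\<close>; as \<open>p\<close> and \<open>q\<close> are coprime, \<open>g\<close>
      divides \<open>k ^ 2 - 1\<close>.\<close>
    have "g dvd x - y" "g dvd k ^ 2 * x - y" unfolding g_def by simp_all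
    moreover have "x - y = (k ^ 2 - 1) * q ^ 2" "k ^ 2 * x - y = (k ^ 2 - 1) * p ^ 2"
      unfolding x_def y_def by (simp_all add: algebra_simps)
    ultimately have "g dvd gcd ((k ^ 2 - 1) * p ^ 2) ((k ^ 2 - 1) * q ^ 2)" by simp
    moreover have "coprime (p ^ 2) (q ^ 2)" using less.prems(3) by simp
    ultimately have gk: "g dvd k ^ 2 - 1" by (simp add: gcd_mult_left coprime_iff_gcd_eq_1)
    have pq: "p \<le> p * q" "q \<le> p * q" using less.prems mult_left_mono[of 1 q p] mult_right_mono[of 1 p q] by auto
    have k0: "k > 0" "k ^ 2 > 1" using k by auto
    from signs show False
    proof
      assume xy: "x > 0 \<and> y > 0"
      then have xA: "p ^ 2 - q ^ 2 = g * A ^ 2" and yB: "p ^ 2 - k ^ 2 * q ^ 2 = g * B ^ 2"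
        using g by (auto simp: x_def y_def)
      have AB': "g * (A ^ 2 - B ^ 2) = (k ^ 2 - 1) * q ^ 2" "g * (k ^ 2 * A ^ 2 - B ^ 2) = (k ^ 2 - 1) * p ^ 2"
        using arg_cong2[of _ _ _ _ "(-)", OF xA yB] arg_cong2[of _ _ _ _ "\<lambda>u v. k ^ 2 * u - v", OF xA yB]
        by (simp_all add: algebra_simps)
      have "q < p" using xy less.prems unfolding x_def by (simp add: power2_less_imp_less)
      have "\<bar>p ^ 2 - q ^ 2\<bar> = g * A ^ 2" "\<bar>g * (A ^ 2 - B ^ 2)\<bar> = (k ^ 2 - 1) * q ^ 2"
        using g k0 unfolding x_def AB'(1) by auto
      with k g(3) gk AB(3) less.prems(3) show False
      proof (cases rule: good_gcd)
        case (1 f)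
        have "1 * q < p * q" using less.prems \<open>q < p\<close> by (intro mult_strict_right_mono) auto
        then show False using descent[of p q "f * A" "f * B"] xA yB 1 less.prems by (simp add: power_mult_distrib)
      next
        case (2 f)
        have "A ^ 2 - B ^ 2 = (f * q) ^ 2" "k ^ 2 * A ^ 2 - B ^ 2 = (f * p) ^ 2"
          using AB' g(3) unfolding 2(2) by (simp_all add: power_mult_distrib)
        moreover have "1 * B ^ 2 \<le> g * B ^ 2" using g(3) by (intro mult_right_mono) auto
        then have "B ^ 2 < p ^ 2" using yB k0 less.prems by (smt (verit) zero_less_mult_iff zero_less_power)
        then have "B < p * q" using pq less.prems by (meson less_le_trans less_imp_le power2_less_imp_less)
        \<comment> \<open>The known squares are \<open>k ^ 2 * A ^ 2 - B ^ 2\<close> and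
          \<open>A ^ 2 - B ^ 2\<close>; multiplying the latter by \<open>k ^ 2\<close> puts them
          into the required form for \<open>P = k * A\<close> and \<open>Q = B\<close>.\<close>
        ultimately show False using descent[of "k * A" B "f * p" "k * f * q"] AB k0
          by (simp add: power_mult_distrib right_diff_distrib[symmetric] mult.assoc)
      qed
    next
      assume xy: "- x > 0 \<and> - y > 0"
      then have xA: "q ^ 2 - p ^ 2 = g * A ^ 2" and yB: "k ^ 2 * q ^ 2 - p ^ 2 = g * B ^ 2"
        using g by (auto simp: x_def y_def)
      have AB': "g * (B ^ 2 - A ^ 2) = (k ^ 2 - 1) * q ^ 2" "g * (B ^ 2 - k ^ 2 * A ^ 2) = (k ^ 2 - 1) * p ^ 2"
        using arg_cong2[of _ _ _ _ "(-)", OF yB xA] arg_cong2[of _ _ _ _ "\<lambda>u v. v - k ^ 2 * u", OF xA yB]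
        by (simp_all add: algebra_simps)
      have "p < q" using xy less.prems unfolding x_def by (simp add: power2_less_imp_less)
      have "\<bar>p ^ 2 - q ^ 2\<bar> = g * A ^ 2" "\<bar>g * (A ^ 2 - B ^ 2)\<bar> = \<bar>g * (B ^ 2 - A ^ 2)\<bar>"
        using g unfolding x_def by (auto simp: abs_mult)
      moreover have "\<bar>g * (B ^ 2 - A ^ 2)\<bar> = (k ^ 2 - 1) * q ^ 2" unfolding AB'(1) using k0 by simp
      ultimately have "\<bar>p ^ 2 - q ^ 2\<bar> = g * A ^ 2" "\<bar>g * (A ^ 2 - B ^ 2)\<bar> = (k ^ 2 - 1) * q ^ 2" by simp_all
      with k g(3) gk AB(3) less.prems(3) show False
      proof (cases rule: good_gcd)
        case (1 f)
        have "p * 1 < p * q" using less.prems \<open>p < q\<close> by (intro mult_strict_left_mono) auto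
        then show False using descent[of "k * q" p "f * B" "k * f * A"] xA yB 1 less.prems k0
          by (simp add: power_mult_distrib right_diff_distrib[symmetric] mult.assoc)
      next
        case (2 f)
        have "B ^ 2 - A ^ 2 = (f * q) ^ 2" "B ^ 2 - k ^ 2 * A ^ 2 = (f * p) ^ 2"
          using AB' g(3) unfolding 2(2) by (simp_all add: power_mult_distrib)
        moreover have "1 * A ^ 2 \<le> g * A ^ 2" using g(3) by (intro mult_right_mono) auto
        then have "A ^ 2 < q ^ 2" using xA less.prems by (smt (verit) zero_less_power)
        then have "A < p * q" using pq less.prems by (meson less_le_trans less_imp_le power2_less_imp_less)
        ultimately show False using descent[of B A "f * q" "f * p"] AB by simp
      qed
    qed
  qed
qed

subsection \<open>Rational points\<close>

lemma rat_square_eq_int: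
  fixes x :: rat
  assumes "x ^ 2 = of_int n"
  obtains m where "x = of_int m" "n = m ^ 2"
proof -
  obtain a b where ab: "x = Rat.Fract a b" "b > 0" "coprime a b" by (cases x)
  then have x: "x = of_int a / of_int b" by (simp add: Fract_of_int_quotient)
  have "rat_of_int (a ^ 2) = of_int (n * b ^ 2)"
    using assms ab(2) unfolding x by (simp add: field_simps)
  then have eq: "a ^ 2 = n * b ^ 2" by (simp only: of_int_eq_iff)
  then have "b ^ 2 dvd a ^ 2" by simp
  then have "b dvd a" by simp
  then have "b = 1" using ab by (metis coprime_common_divisor dvd_refl zdvd1_eq abs_of_pos)
  then show thesis using that[of a] x eq by simp
qed

lemma int_not_square:
  fixes j n m :: int
  assumes "j \<ge> 0" "j ^ 2 < n" "n < (j + 1) ^ 2"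
  shows "n \<noteq> m ^ 2"
proof
  assume "n = m ^ 2"
  then have "j ^ 2 < \<bar>m\<bar> ^ 2" "\<bar>m\<bar> ^ 2 < (j + 1) ^ 2" using assms by simp_all
  then have "j < \<bar>m\<bar>" "\<bar>m\<bar> < j + 1" 
    using power2_less_imp_less[of j "\<bar>m\<bar>"] power2_less_imp_less[of "\<bar>m\<bar>" "j + 1"] assms(1)
    by simp_all
  then show False by simp
qed

lemma quartic_rational_points:
  fixes r s :: rat and k :: int
  assumes k: "k = 3 \<or> k = 9" and eq: "(r ^ 2 - 1) * (r ^ 2 - of_int k ^ 2) = s ^ 2"
  shows "r = 0 \<or> r ^ 2 = 1 \<or> r ^ 2 = of_int k ^ 2"
proof (rule ccontr)
  assume neg: "\<not> ?thesis"
  obtain a b where ab: "r = Rat.Fract a b" "b > 0" "coprime a b" by (cases r)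
  then have r: "r = of_int a / of_int b" by (simp add: Fract_of_int_quotient)
  have b0: "rat_of_int b \<noteq> 0" using ab by simp
  define t where "t = (a ^ 2 - b ^ 2) * (a ^ 2 - k ^ 2 * b ^ 2)"
  have a: "rat_of_int a = r * of_int b" using b0 by (simp add: r)
  have t: "of_int t = (s * of_int b ^ 2) ^ 2"
    unfolding t_def power_mult_distrib eq[symmetric]
    by (simp add: a algebra_simps power2_eq_square)
  then obtain m where m: "s * of_int b ^ 2 = of_int m" "t = m ^ 2"
    using rat_square_eq_int by metis
  have "a \<noteq> 0" using neg r by auto
  then have "m = 0" using m(2) ab(2,3) square_mult_no_solution[OF k, of "\<bar>a\<bar>" b m]
    unfolding t_def by simp
  then have "s = 0" using m(1) b0 by simp
  then show False using eq neg by auto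
qed

lemma elliptic_rational_points:
  fixes \<xi> v :: rat
  assumes "v ^ 2 = \<xi> * (5 * \<xi> - 1) * (\<xi> + 3)"
  shows "\<xi> \<in> {0, 1 / 5, - 3, 1, - 3 / 5}"
proof (rule ccontr)
  assume neg: "\<not> ?thesis"
  define w where "w = 5 * \<xi> - 1"
  have \<xi>: "\<xi> = (w + 1) / 5" by (simp add: w_def)
  have w: "w \<noteq> 0" "w \<noteq> 4" "w \<noteq> - 4" "w \<noteq> - 1" "w \<noteq> - 16" using neg unfolding \<xi> by auto
  define u where "u = 5 * v"
  have u: "u ^ 2 = w * (w + 1) * (w + 16)"
    unfolding u_def power_mult_distrib assms \<xi> by (simp add: field_simps)
  then have u0: "u \<noteq> 0" using w by (auto simp: add_eq_0_iff2)
  \<comment> \<open>This \<open>r\<close> is invariant under translation by the 2-torsion point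
    \<open>(0, 0)\<close>, which sends \<open>w\<close> to \<open>16 / w\<close>; it gives a
    2-isogeny onto the quartic with \<open>k = 9\<close>. The excluded \<open>w\<close> are those
    with \<open>r = 0\<close> or a vanishing denominator, and \<open>w = - 1\<close>,
    \<open>w = - 16\<close> are the points with \<open>u = 0\<close>.\<close>
  define r where "r = u * (w + 4) / (w * (w - 4))"
  have w4: "w - 4 \<noteq> 0" "w + 4 \<noteq> 0" using w by (auto simp: add_eq_0_iff2)
  have "r ^ 2 = u ^ 2 * (w + 4) ^ 2 / (w * (w - 4)) ^ 2"
    by (simp add: r_def power_divide power_mult_distrib)
  also have "\<dots> = (w * ((w + 1) * (w + 16) * (w + 4) ^ 2)) / (w * (w * (w - 4) ^ 2))"
    unfolding u by (simp add: power2_eq_square mult_ac)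
  finally have r2: "r ^ 2 = (w + 1) * (w + 16) * (w + 4) ^ 2 / (w * (w - 4) ^ 2)"
    using w(1) by simp
  have r1: "r ^ 2 - 1 = (w ^ 2 + 12 * w + 16) ^ 2 / (w * (w - 4) ^ 2)"
    unfolding r2 using w(1) w4 by (simp add: field_simps) (simp add: power2_eq_square algebra_simps)
  have r9: "r ^ 2 - 81 = (w ^ 2 - 28 * w + 16) ^ 2 / (w * (w - 4) ^ 2)"
    unfolding r2 using w(1) w4 by (simp add: field_simps) (simp add: power2_eq_square algebra_simps)
  have "(r ^ 2 - 1) * (r ^ 2 - of_int 9 ^ 2) =
      ((w ^ 2 + 12 * w + 16) * (w ^ 2 - 28 * w + 16) / (w * (w - 4) ^ 2)) ^ 2"
    using r1 r9 by (simp add: power_mult_distrib power_divide power2_eq_square)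
  from quartic_rational_points[OF _ this] have "r = 0 \<or> r ^ 2 - 1 = 0 \<or> r ^ 2 - 81 = 0" by simp
  moreover have "r \<noteq> 0" using u0 w w4 by (simp add: r_def)
  \<comment> \<open>The quadratics arising here and for \<open>r ^ 2 = 81\<close> have discriminants
    80 and 720, both 5 times a square.\<close>
  moreover have False if "r ^ 2 - 1 = 0"
  proof -
    have "w ^ 2 + 12 * w + 16 = 0" using that w(1) w4 unfolding r1 by simp
    then have "((w + 6) / 2) ^ 2 = of_int 5" by (simp add: power2_eq_square field_simps)
    then obtain m :: int where "5 = m ^ 2" by (rule rat_square_eq_int)
    then show False using int_not_square[of 2 5 m] by simp
  qed
  moreover have False if "r ^ 2 - 81 = 0"
  proof -
    have "w ^ 2 - 28 * w + 16 = 0" using that w(1) w4 unfolding r9 by simp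
    then have "((w - 14) / 6) ^ 2 = of_int 5" by (simp add: power2_eq_square field_simps)
    then obtain m :: int where "5 = m ^ 2" by (rule rat_square_eq_int)
    then show False using int_not_square[of 2 5 m] by simp
  qed
  ultimately show False by blast
qed

lemma quartic_product_rational_points:
  fixes \<xi> v :: rat
  assumes "v ^ 2 = ((5 * \<xi> - 1) * (\<xi> + 3)) * (- (3 * \<xi> + 1) * (\<xi> - 5))"
  shows "\<xi> \<in> {1, - 1, 5, 1 / 5, - 3, - 1 / 3}"
proof (cases "\<xi> = - 1")
  case False
  then have X1: "\<xi> + 1 \<noteq> 0" by (simp add: eq_neg_iff_add_eq_0)
  \<comment> \<open>This Moebius map sends the roots 5, 1/5, -3, -1/3 of the quartic to 1, -1, 3,
    -3. Its pole is the value -1 treated separately, and it vanishes at 1.\<close>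
  define r where "r = 3 * (\<xi> - 1) / (2 * (\<xi> + 1))"
  define D where "D = 4 * (\<xi> + 1) ^ 2"
  have D: "D \<noteq> 0" using X1 by (simp add: D_def)
  have r1: "r ^ 2 - 1 = (\<xi> - 5) * (5 * \<xi> - 1) / D"
    unfolding r_def D_def using X1 by (simp add: field_simps) (simp add: power2_eq_square algebra_simps)
  have r9: "r ^ 2 - 9 = - 9 * (\<xi> + 3) * (3 * \<xi> + 1) / D"
    unfolding r_def D_def using X1 by (simp add: field_simps) (simp add: power2_eq_square algebra_simps)
  have "(r ^ 2 - 1) * (r ^ 2 - 9) = ((\<xi> - 5) * (5 * \<xi> - 1) * (- 9 * (\<xi> + 3) * (3 * \<xi> + 1))) / D ^ 2"
    unfolding r1 r9 by (simp add: power2_eq_square)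
  also have "(\<xi> - 5) * (5 * \<xi> - 1) * (- 9 * (\<xi> + 3) * (3 * \<xi> + 1)) = (3 * v) ^ 2"
    unfolding power_mult_distrib assms by (simp add: algebra_simps)
  also have "(3 * v) ^ 2 / D ^ 2 = (3 * v / D) ^ 2" by (simp add: power_divide)
  finally have "r = 0 \<or> r ^ 2 - 1 = 0 \<or> r ^ 2 - 9 = 0"
    using quartic_rational_points[of 3 r "3 * v / D"] by fastforce
  then have "\<xi> - 1 = 0 \<or> \<xi> - 5 = 0 \<or> 5 * \<xi> - 1 = 0 \<or> \<xi> + 3 = 0 \<or> 3 * \<xi> + 1 = 0"
    unfolding r1 r9 using X1 D by (auto simp: r_def)
  then show ?thesis by (elim disjE) (auto simp: field_simps add_eq_0_iff2)
qed simp

subsection \<open>Points over quadratic fields\<close>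

lemma Rats_square_eq_int:
  fixes x :: complex
  assumes "x \<in> \<rat>" "x ^ 2 = of_int n"
  shows "\<exists>m. n = m ^ 2"
proof -
  obtain q where q: "x = of_rat q" using assms(1) by (rule Rats_cases)
  then have "of_rat (q ^ 2) = (of_rat (of_int n) :: complex)" using assms(2) by (simp add: of_rat_power)
  then have "q ^ 2 = of_int n" by (simp only: of_rat_eq_iff)
  then show ?thesis using rat_square_eq_int by metis
qed

lemma not_Rats_sqrt:
  fixes x :: complex and j n :: int
  assumes "x ^ 2 = of_int n" "j \<ge> 0" "j ^ 2 < n" "n < (j + 1) ^ 2"
  shows "x \<notin> \<rat>"
  using Rats_square_eq_int[OF _ assms(1)] int_not_square[OF assms(2-4)] by blast

lemma not_Rats_sqrt_neg:
  fixes x :: complex and n :: int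
  assumes "x ^ 2 = of_int n" "n < 0"
  shows "x \<notin> \<rat>"
  using Rats_square_eq_int[OF _ assms(1)] assms(2) by (metis not_less zero_le_power2)

lemma elliptic_Rats:
  fixes \<xi> v :: complex
  assumes "\<xi> \<in> \<rat>" "v \<in> \<rat>" "v ^ 2 = \<xi> * (5 * \<xi> - 1) * (\<xi> + 3)"
  shows "\<xi> \<in> {0, 1 / 5, - 3, 1, - 3 / 5}"
proof -
  obtain p q where pq: "\<xi> = of_rat p" "v = of_rat q" using assms(1,2) by (metis Rats_cases)
  have "of_rat (q ^ 2) = (of_rat (p * (5 * p - 1) * (p + 3)) :: complex)"
    using assms(3) unfolding pq by (simp add: of_rat_power of_rat_mult of_rat_add of_rat_diff)
  then have "p \<in> {0, 1 / 5, - 3, 1, - 3 / 5}"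
    unfolding of_rat_eq_iff by (rule elliptic_rational_points)
  then have "\<xi> \<in> of_rat ` {0, 1 / 5, - 3, 1, - 3 / 5}" unfolding pq by (rule imageI)
  then show ?thesis by (simp add: of_rat_divide of_rat_minus)
qed

lemma quartic_product_Rats:
  fixes \<xi> v :: complex
  assumes "\<xi> \<in> \<rat>" "v \<in> \<rat>" "v ^ 2 = ((5 * \<xi> - 1) * (\<xi> + 3)) * (- (3 * \<xi> + 1) * (\<xi> - 5))"
  shows "\<xi> \<in> {1, - 1, 5, 1 / 5, - 3, - 1 / 3}"
proof -
  obtain p q where pq: "\<xi> = of_rat p" "v = of_rat q" using assms(1,2) by (metis Rats_cases)
  have "of_rat (q ^ 2) = (of_rat (((5 * p - 1) * (p + 3)) * (- (3 * p + 1) * (p - 5))) :: complex)"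
    using assms(3) unfolding pq
    by (simp add: of_rat_power of_rat_mult of_rat_add of_rat_diff of_rat_minus)
  then have "p \<in> {1, - 1, 5, 1 / 5, - 3, - 1 / 3}"
    unfolding of_rat_eq_iff by (rule quartic_product_rational_points)
  then have "\<xi> \<in> of_rat ` {1, - 1, 5, 1 / 5, - 3, - 1 / 3}" unfolding pq by (rule imageI)
  then show ?thesis by (simp add: of_rat_divide of_rat_minus)
qed

lemma Rats_linear_eq_0:
  fixes \<xi> c d :: complex
  assumes "\<xi> \<notin> \<rat>" "c \<in> \<rat>" "d \<in> \<rat>" "c * \<xi> + d = 0"
  shows "c = 0 \<and> d = 0"
proof -
  have "c = 0"
  proof (rule ccontr)
    assume "c \<noteq> 0"
    then have "\<xi> = - d / c" using assms(4) by (simp add: field_simps eq_neg_iff_add_eq_0)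
    then show False using assms by simp
  qed
  then show ?thesis using assms(4) by simp
qed

text \<open>Here \<open>T\<close> and \<open>n ^ 2\<close> are the trace and norm of \<xi>, and
  \<open>a\<close>, \<open>b\<close> are the coefficients of the line through the point and its
  conjugate.\<close>

lemma irrational_point_trace:
  fixes \<xi> T n a b :: complex
  assumes \<xi>: "\<xi> \<notin> \<rat>" "\<xi> ^ 2 = T * \<xi> - n ^ 2"
    and Q: "T \<in> \<rat>" "n \<in> \<rat>" "a \<in> \<rat>" "b \<in> \<rat>"
    and point: "(a * \<xi> + b) ^ 2 = \<xi> * (5 * \<xi> - 1) * (\<xi> + 3)"
  shows "T = 5 * n ^ 2 - 3"
proof -
  define N where "N = n ^ 2"
  have XX: "\<xi> ^ 2 = T * \<xi> - N" using \<xi>(2) by (simp add: N_def)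
  have N: "N \<in> \<rat>" using Q by (simp add: N_def)
  \<comment> \<open>Both sides of \<open>point\<close> are reduced modulo the minimal polynomial of
    \<xi>; the coefficients of \<xi> and 1 then vanish separately.\<close>
  have "(a ^ 2 * T + 2 * a * b - (5 * (T ^ 2 - N) + 14 * T - 3)) * \<xi>
      + (b ^ 2 - a ^ 2 * N + 5 * T * N + 14 * N) = 0"
  proof -
    have X3: "\<xi> * \<xi> ^ 2 = (T ^ 2 - N) * \<xi> - T * N"
    proof -
      have "\<xi> * \<xi> ^ 2 = T * \<xi> ^ 2 - N * \<xi>" by (subst XX) (simp add: algebra_simps power2_eq_square)
      also have "\<dots> = (T ^ 2 - N) * \<xi> - T * N" unfolding XX by (simp add: algebra_simps power2_eq_square)
      finally show ?thesis .
    qed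
    have "(a * \<xi> + b) ^ 2 = a ^ 2 * \<xi> ^ 2 + 2 * a * b * \<xi> + b ^ 2"
      by (simp add: power2_eq_square algebra_simps)
    moreover have "\<xi> * (5 * \<xi> - 1) * (\<xi> + 3) = 5 * (\<xi> * \<xi> ^ 2) + 14 * \<xi> ^ 2 - 3 * \<xi>"
      by (simp add: power2_eq_square algebra_simps)
    ultimately have "a ^ 2 * (T * \<xi> - N) + 2 * a * b * \<xi> + b ^ 2
        = 5 * ((T ^ 2 - N) * \<xi> - T * N) + 14 * (T * \<xi> - N) - 3 * \<xi>"
      using point XX X3 by simp
    then show ?thesis by (simp add: algebra_simps)
  qed
  then have "a ^ 2 * T + 2 * a * b - (5 * (T ^ 2 - N) + 14 * T - 3) = 0
      \<and> b ^ 2 - a ^ 2 * N + 5 * T * N + 14 * N = 0"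
    using Q N by (intro Rats_linear_eq_0[OF \<xi>(1)]) simp_all
  then have lin: "2 * a * b = 5 * (T ^ 2 - N) + 14 * T - 3 - a ^ 2 * T"
    and const: "b ^ 2 = a ^ 2 * N - 5 * T * N - 14 * N"
    by (auto simp: algebra_simps)
  \<comment> \<open>By the sum of the roots, \<open>X0\<close> is the third root of
    \<open>5 X^3 + 14 X^2 - 3 X - (a X + b)^2\<close>; \<open>b2\<close> and \<open>ab\<close> are
    the other two Vieta relations.\<close>
  define X0 v0 where "X0 = (a ^ 2 - 14) / 5 - T" and "v0 = a * X0 + b"
  have a2: "a ^ 2 = 5 * X0 + 5 * T + 14" by (simp add: X0_def field_simps)
  have b2: "b ^ 2 = 5 * N * X0" unfolding const a2 by (simp add: algebra_simps)
  have ab: "2 * a * b = - 5 * N - 5 * T * X0 - 3"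
    unfolding lin a2 by (simp add: algebra_simps power2_eq_square)
  have rat0: "X0 \<in> \<rat>" "v0 \<in> \<rat>" using Q by (simp_all add: X0_def v0_def)
  have "v0 ^ 2 = a ^ 2 * X0 ^ 2 + (2 * a * b) * X0 + b ^ 2"
    by (simp add: v0_def power2_eq_square algebra_simps)
  also have "\<dots> = X0 * (5 * X0 - 1) * (X0 + 3)"
    unfolding a2 ab b2 by (simp add: algebra_simps power2_eq_square)
  finally have v0: "v0 ^ 2 = X0 * (5 * X0 - 1) * (X0 + 3)" .
  have "n \<noteq> 0"
  proof
    assume "n = 0"
    then have "\<xi> * (\<xi> - T) = 0" using \<xi>(2) by (simp add: power2_eq_square algebra_simps)
    then show False using \<xi>(1) Q by auto
  qed
  \<comment> \<open>Thus \<open>5 * X0\<close> is a rational square. The candidates -3, 1, -3/5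
    would give -15, 5, -3, and 0 would give \<open>5 * n ^ 2 = - 3\<close>.\<close>
  then have "(b / n) ^ 2 = 5 * X0" using b2 by (simp add: N_def power_divide)
  moreover have "b / n \<in> \<rat>" using Q by simp
  moreover have "X0 \<noteq> - 3" if "(b / n) ^ 2 = 5 * X0"
    using that not_Rats_sqrt_neg[of "b / n" "- 15"] \<open>b / n \<in> \<rat>\<close> by auto
  moreover have "X0 \<noteq> 1" if "(b / n) ^ 2 = 5 * X0"
    using that not_Rats_sqrt[of "b / n" 5 2] \<open>b / n \<in> \<rat>\<close> by auto
  moreover have "X0 \<noteq> - 3 / 5" if "(b / n) ^ 2 = 5 * X0"
    using that not_Rats_sqrt_neg[of "b / n" "- 3"] \<open>b / n \<in> \<rat>\<close> by auto
  moreover have "X0 \<noteq> 0"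
  proof
    assume "X0 = 0"
    then have "b = 0" using b2 by simp
    then have "0 = - 5 * n ^ 2 - 3" using ab \<open>X0 = 0\<close> unfolding N_def by simp
    then have "3 = - (5 * n ^ 2)" by (simp add: eq_diff_eq)
    then have "5 * n ^ 2 = - 3" by (rule equation_minus_iff[THEN iffD1])
    then have "(5 * n) ^ 2 = of_int (- 15)" unfolding power_mult_distrib by (simp add: power2_eq_square)
    then show False using not_Rats_sqrt_neg[of "5 * n" "- 15"] Q by simp
  qed
  ultimately have X0: "X0 = 1 / 5" using elliptic_Rats[OF rat0 v0] by auto
  have "v0 = 0" using v0 unfolding X0 by simp
  then have "b = - a / 5" using X0 by (simp add: v0_def eq_neg_iff_add_eq_0 add.commute)
  then have "a ^ 2 = 25 * N" using b2 X0 by (simp add: power_divide)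
  then have "5 * T = 5 * (5 * n ^ 2 - 3)" using a2 X0 by (simp add: N_def algebra_simps)
  then show ?thesis unfolding mult_cancel_left by simp
qed

text \<open>The assumption \<open>dep\<close> expresses \<open>[K : \<rat>] \<le> 2\<close>: an
  irrational element and 1 span \<open>K\<close>. Squaring \<open>b = c * a + d\<close> shows that
  \<open>2 * c * d * a\<close> is rational, so \<open>c\<close> or \<open>d\<close> is 0.\<close>

lemma quadratic_dependence:
  fixes a b :: complex and K :: "complex set"
  assumes dep: "\<And>a b. a \<in> K \<Longrightarrow> b \<in> K \<Longrightarrow> a \<notin> \<rat> \<Longrightarrow> \<exists>c\<in>\<rat>. \<exists>d\<in>\<rat>. b = c * a + d"
    and ab: "a \<in> K" "b \<in> K" "a ^ 2 \<in> \<rat>" "b ^ 2 \<in> \<rat>"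
  shows "a \<in> \<rat> \<or> b \<in> \<rat> \<or> a * b \<in> \<rat>"
proof (cases "a \<in> \<rat>")
  case False
  then obtain c d where cd: "c \<in> \<rat>" "d \<in> \<rat>" "b = c * a + d" using dep ab by blast
  have "(2 * c * d) * a + (c ^ 2 * a ^ 2 + d ^ 2 - b ^ 2) = 0"
    unfolding cd(3) by (simp add: power2_eq_square algebra_simps)
  then have "2 * c * d = 0" using Rats_linear_eq_0[OF False] cd ab by (metis (no_types, lifting)
    Rats_add Rats_diff Rats_mult Rats_number_of Rats_power)
  then consider "c = 0" | "d = 0" by auto
  then show ?thesis
  proof cases
    case 2
    then have "a * b = c * a ^ 2" using cd by (simp add: power2_eq_square)
    then show ?thesis using cd ab by simp
  qed (use cd in simp)
qed simp

lemma reciprocal_cubic: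
  fixes \<xi> :: complex
  assumes "\<xi> \<noteq> 0"
  shows "(- (3 * \<xi> + 1) * (\<xi> - 5)) / \<xi> ^ 3 = (1 / \<xi>) * (5 * (1 / \<xi>) - 1) * ((1 / \<xi>) + 3)"
proof -
  have "5 * (1 / \<xi>) - 1 = (5 - \<xi>) / \<xi>" "1 / \<xi> + 3 = (1 + 3 * \<xi>) / \<xi>"
    using assms by (simp_all add: diff_divide_distrib add_divide_distrib)
  moreover have "- (3 * \<xi> + 1) * (\<xi> - 5) = (5 - \<xi>) * (1 + 3 * \<xi>)" by (simp add: algebra_simps)
  ultimately show ?thesis by (simp only: times_divide_times_eq mult_1 power3_eq_cube)
qed

text \<open>The map \<open>(x, y, z) \<mapsto> (1 / x, z / x\<^sup>2, y / x\<^sup>2)\<close> is an automorphism of the curve; it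
  exchanges the two elliptic quotients.\<close>

lemma square_coordinate_rational:
  fixes x y z :: complex and K :: "complex set"
  assumes dep: "\<And>a b. a \<in> K \<Longrightarrow> b \<in> K \<Longrightarrow> a \<notin> \<rat> \<Longrightarrow> \<exists>c\<in>\<rat>. \<exists>d\<in>\<rat>. b = c * a + d"
    and K: "\<And>a b. a \<in> K \<Longrightarrow> b \<in> K \<Longrightarrow> a * b \<in> K" "\<And>a. a \<in> K \<Longrightarrow> inverse a \<in> K"
    and xyz: "x \<in> K" "y \<in> K" "z \<in> K"
    and y: "y ^ 2 = (5 * x ^ 2 - 1) * (x ^ 2 + 3)"
    and z: "z ^ 2 = - (3 * x ^ 2 + 1) * (x ^ 2 - 5)"
  shows "x ^ 2 \<in> \<rat>"
proof (rule ccontr)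
  assume irr: "x ^ 2 \<notin> \<rat>"
  then have "x \<notin> \<rat>" by auto
  moreover have "x ^ 2 \<in> K" using K xyz by (simp add: power2_eq_square)
  ultimately obtain t m where tm: "t \<in> \<rat>" "m \<in> \<rat>" "x ^ 2 = t * x + m" using dep xyz by blast
  \<comment> \<open>The norm of \<open>x\<close> is \<open>- m\<close>, so \<xi> has norm
    \<open>m ^ 2\<close> and trace \<open>t ^ 2 + 2 * m\<close>.\<close>
  define \<xi> T n where "\<xi> = x ^ 2" and "T = t ^ 2 + 2 * m" and "n = m"
  have Q: "T \<in> \<rat>" "n \<in> \<rat>" using tm by (simp_all add: T_def n_def)
  have \<xi>: "\<xi> ^ 2 = T * \<xi> - n ^ 2"
  proof -
    have tx: "t * x = \<xi> - m" using tm by (simp add: \<xi>_def)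
    have "(t * x) ^ 2 = t ^ 2 * \<xi>" by (simp add: \<xi>_def power_mult_distrib)
    then show ?thesis unfolding tx T_def n_def by (simp add: power2_eq_square algebra_simps)
  qed
  have X0: "\<xi> \<noteq> 0" "x \<noteq> 0" using irr by (auto simp: \<xi>_def)
  have n0: "n \<noteq> 0"
  proof
    assume "n = 0"
    then have "\<xi> * (\<xi> - T) = 0" using \<xi> by (simp add: power2_eq_square algebra_simps)
    then show False using irr Q X0 by (auto simp: \<xi>_def)
  qed
  have "x * y \<in> K" using K xyz by simp
  then obtain a b where ab: "a \<in> \<rat>" "b \<in> \<rat>" "x * y = a * \<xi> + b"
    using dep[OF \<open>x ^ 2 \<in> K\<close>] irr \<xi>_def by blast
  have "(x * y) ^ 2 = \<xi> * (5 * \<xi> - 1) * (\<xi> + 3)"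
    unfolding power_mult_distrib y \<xi>_def by simp
  then have "(a * \<xi> + b) ^ 2 = \<xi> * (5 * \<xi> - 1) * (\<xi> + 3)" unfolding ab(3) .
  then have T: "T = 5 * n ^ 2 - 3"
    using irrational_point_trace[OF _ \<xi> Q ab(1,2)] irr \<xi>_def by simp
  have irr': "1 / \<xi> \<notin> \<rat>" using irr \<xi>_def by (metis Rats_divide Rats_1 divide_divide_eq_right div_by_1 mult_1)
  have "inverse (x * x) \<in> K" using K xyz by simp
  then have iK: "1 / \<xi> \<in> K" by (simp add: \<xi>_def power2_eq_square divide_inverse)
  \<comment> \<open>This is the product of the first two coordinates of the image point under the
    automorphism.\<close>
  have "inverse (x * x) * inverse x * z \<in> K" using K xyz by simp
  moreover have "inverse (x * x) * inverse x * z = z / (\<xi> * x)"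
    by (simp add: \<xi>_def power2_eq_square divide_inverse mult_ac)
  ultimately have "z / (\<xi> * x) \<in> K" by simp
  then obtain c d where cd: "c \<in> \<rat>" "d \<in> \<rat>" "z / (\<xi> * x) = c * (1 / \<xi>) + d"
    using dep[OF iK _ irr'] by blast
  have "(z / (\<xi> * x)) ^ 2 = (- (3 * \<xi> + 1) * (\<xi> - 5)) / \<xi> ^ 3"
    unfolding power_divide power_mult_distrib z \<xi>_def by (simp add: eval_nat_numeral mult_ac)
  also have "\<dots> = (1 / \<xi>) * (5 * (1 / \<xi>) - 1) * ((1 / \<xi>) + 3)"
    by (rule reciprocal_cubic[OF X0(1)])
  finally have c: "(z / (\<xi> * x)) ^ 2 = (1 / \<xi>) * (5 * (1 / \<xi>) - 1) * ((1 / \<xi>) + 3)" .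
  then have c: "(c * (1 / \<xi>) + d) ^ 2 = (1 / \<xi>) * (5 * (1 / \<xi>) - 1) * ((1 / \<xi>) + 3)" unfolding cd(3) .
  \<comment> \<open>The trace and norm of \<open>1 / \<xi>\<close> are \<open>T / n ^ 2\<close> and
    \<open>1 / n ^ 2\<close>.\<close>
  have X': "(1 / \<xi>) ^ 2 = (T / n ^ 2) * (1 / \<xi>) - (1 / n) ^ 2"
  proof -
    have "(T / n ^ 2) * (1 / \<xi>) - (1 / n) ^ 2 = (T * \<xi> - \<xi> ^ 2) / (n ^ 2 * \<xi> ^ 2)"
      using X0 n0 by (simp add: diff_divide_distrib power2_eq_square)
    also have "T * \<xi> - \<xi> ^ 2 = n ^ 2" unfolding \<xi> by simp
    finally show ?thesis using n0 by (simp add: power_divide)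
  qed
  have "T / n ^ 2 = 5 * (1 / n) ^ 2 - 3"
    using irrational_point_trace[OF irr' X' _ _ cd(1,2) c] Q by simp
  then have "T / n ^ 2 * n ^ 2 = (5 * (1 / n) ^ 2 - 3) * n ^ 2" by (rule arg_cong)
  then have "T = 5 - 3 * n ^ 2" using n0 by (simp add: left_diff_distrib power_divide)
  then have "n ^ 2 = 1" using T by simp
  then have "(\<xi> - 1) ^ 2 = 0" using \<xi> T by (simp add: power2_eq_square algebra_simps)
  then have "\<xi> = 1" by simp
  then show False using irr \<xi>_def by simp
qed

text \<open>Two distinct quadratic fields cannot both lie in \<open>K\<close>. The factor
  \<open>c\<close> clears denominators, so that only integers have to be tested for being
  squares.\<close>

lemma quadratic_not_both:
  fixes a b c :: complex and K :: "complex set" and m n :: int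
  assumes dep: "\<And>a b. a \<in> K \<Longrightarrow> b \<in> K \<Longrightarrow> a \<notin> \<rat> \<Longrightarrow> \<exists>c\<in>\<rat>. \<exists>d\<in>\<rat>. b = c * a + d"
    and ab: "a \<in> K" "b \<in> K" "a ^ 2 \<in> \<rat>" "b ^ 2 \<in> \<rat>"
    and c: "c \<in> \<rat>" and eq: "(c * a) ^ 2 = of_int m" "(c * b) ^ 2 = of_int n"
    and nonsq: "\<And>i. m \<noteq> i ^ 2" "\<And>i. n \<noteq> i ^ 2" "\<And>i. m * n \<noteq> i ^ 2"
  shows False
proof -
  have "(c ^ 2 * (a * b)) ^ 2 = (c * a) ^ 2 * (c * b) ^ 2" by (simp add: power2_eq_square)
  then have eq': "(c ^ 2 * (a * b)) ^ 2 = of_int (m * n)" unfolding eq by simp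
  have "a \<in> \<rat> \<or> b \<in> \<rat> \<or> a * b \<in> \<rat>" by (rule quadratic_dependence[OF dep ab])
  then have "c * a \<in> \<rat> \<or> c * b \<in> \<rat> \<or> c ^ 2 * (a * b) \<in> \<rat>" using c by auto
  then show False using eq eq' nonsq Rats_square_eq_int by metis
qed

lemma neg_not_square: "n < 0 \<Longrightarrow> n \<noteq> i ^ 2" for i n :: int
  by (metis not_less zero_le_power2)

lemma rational_square_coordinate:
  fixes x y z :: complex and K :: "complex set"
  assumes dep: "\<And>a b. a \<in> K \<Longrightarrow> b \<in> K \<Longrightarrow> a \<notin> \<rat> \<Longrightarrow> \<exists>c\<in>\<rat>. \<exists>d\<in>\<rat>. b = c * a + d"
    and xyz: "x \<in> K" "y \<in> K" "z \<in> K"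
    and y: "y ^ 2 = (5 * x ^ 2 - 1) * (x ^ 2 + 3)"
    and z: "z ^ 2 = - (3 * x ^ 2 + 1) * (x ^ 2 - 5)"
    and rat: "x ^ 2 \<in> \<rat>"
  shows "x ^ 2 = 1"
proof -
  have yz_rat: "y ^ 2 \<in> \<rat>" "z ^ 2 \<in> \<rat>" unfolding y z using rat by simp_all
  define \<xi> where "\<xi> = x ^ 2"
  have rX: "\<xi> \<in> \<rat>" using rat by (simp add: \<xi>_def)
  \<comment> \<open>Each pair of coordinates has a rational member or a rational product. If no
    product were rational, two coordinates would be rational, and hence their product too.\<close>
  have cases: "x * y \<in> \<rat> \<or> x * z \<in> \<rat> \<or> y * z \<in> \<rat>"
    using quadratic_dependence[OF dep xyz(1,2) rat yz_rat(1)]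
      quadratic_dependence[OF dep xyz(1,3) rat yz_rat(2)]
      quadratic_dependence[OF dep xyz(2,3) yz_rat] Rats_mult by blast
  have xy: "\<xi> \<in> {0, 1 / 5, - 3, 1, - 3 / 5}" if "x * y \<in> \<rat>"
    using rat that by (intro elliptic_Rats[of \<xi> "x * y"]) (simp_all add: \<xi>_def power_mult_distrib y)
  have xz: "\<xi> = 0 \<or> 1 / \<xi> \<in> {0, 1 / 5, - 3, 1, - 3 / 5}" if "x * z \<in> \<rat>"
  proof (cases "\<xi> = 0")
    case False
    have "(x * z / \<xi> ^ 2) ^ 2 = \<xi> * (- (3 * \<xi> + 1) * (\<xi> - 5)) / (\<xi> ^ 2) ^ 2"
      by (simp add: \<xi>_def power_divide power_mult_distrib z)
    also have "\<dots> = (- (3 * \<xi> + 1) * (\<xi> - 5)) / \<xi> ^ 3"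
      using False by (simp add: eval_nat_numeral)
    also have "\<dots> = 1 / \<xi> * (5 * (1 / \<xi>) - 1) * (1 / \<xi> + 3)"
      by (rule reciprocal_cubic[OF False])
    finally show ?thesis using rX that by (intro disjI2 elliptic_Rats[of _ "x * z / \<xi> ^ 2"]) simp_all
  qed simp
  have yz: "\<xi> \<in> {1, - 1, 5, 1 / 5, - 3, - 1 / 3}" if "y * z \<in> \<rat>"
    using rat that by (intro quartic_product_Rats[of \<xi> "y * z"]) (simp_all add: \<xi>_def power_mult_distrib y z)
  have "1 / \<xi> = c \<Longrightarrow> \<xi> = 1 / c" for c by auto
  then have \<xi>: "\<xi> = 1 \<or> \<xi> = - 1 \<or> \<xi> = 5 \<or> \<xi> = 1 / 5 \<or> \<xi> = - 3 \<or> \<xi> = - 1 / 3 \<or> \<xi> = 0 \<or> \<xi> = - 3 / 5 \<or> \<xi> = - 5 / 3"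
    using cases xy xz yz by fastforce
  note clash_xy = quadratic_not_both[OF dep xyz(1,2) rat yz_rat(1)]
  note clash_xz = quadratic_not_both[OF dep xyz(1,3) rat yz_rat(2)]
  note clash_yz = quadratic_not_both[OF dep xyz(2,3) yz_rat]
  have sq: "x ^ 2 = \<xi>" "y ^ 2 = (5 * \<xi> - 1) * (\<xi> + 3)" "z ^ 2 = - (3 * \<xi> + 1) * (\<xi> - 5)"
    by (simp_all add: \<xi>_def y z)
  \<comment> \<open>For every candidate other than 1, two of the coordinates generate distinct
    quadratic fields. The arguments are the scaling factor and the two scaled squares.\<close>
  have "False" if "\<xi> = - 1"
    by (rule clash_xy[of 1 "- 1" "- 12"])
      (use int_not_square[of 3 12] in
        \<open>simp_all add: neg_not_square power_mult_distrib sq[unfolded that]\<close>)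
  moreover have "False" if "\<xi> = 5"
    by (rule clash_xy[of 1 5 192])
      (use int_not_square[of 2 5] int_not_square[of 13 192] int_not_square[of 30 960] in
        \<open>simp_all add: neg_not_square power_mult_distrib sq[unfolded that]\<close>)
  moreover have "False" if "\<xi> = 1 / 5"
    by (rule clash_xz[of 5 5 192])
      (use int_not_square[of 2 5] int_not_square[of 13 192] int_not_square[of 30 960] in
        \<open>simp_all add: neg_not_square power_mult_distrib sq[unfolded that]\<close>)
  moreover have "False" if "\<xi> = - 3"
    by (rule clash_xz[of 1 "- 3" "- 64"])
      (use int_not_square[of 13 192] in
        \<open>simp_all add: neg_not_square power_mult_distrib sq[unfolded that]\<close>)
  moreover have "False" if "\<xi> = - 1 / 3"
    by (rule clash_xy[of 3 "- 3" "- 64"])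
      (use int_not_square[of 13 192] in
        \<open>simp_all add: neg_not_square power_mult_distrib sq[unfolded that]\<close>)
  moreover have "False" if "\<xi> = 0"
    by (rule clash_yz[of 1 "- 3" 5])
      (use int_not_square[of 2 5] in
        \<open>simp_all add: neg_not_square power_mult_distrib sq[unfolded that]\<close>)
  moreover have "False" if "\<xi> = - 3 / 5"
    by (rule clash_xz[of 5 "- 15" "- 112"])
      (use int_not_square[of 40 1680] in
        \<open>simp_all add: neg_not_square power_mult_distrib sq[unfolded that]\<close>)
  moreover have "False" if "\<xi> = - 5 / 3"
    by (rule clash_xy[of 3 "- 15" "- 112"])
      (use int_not_square[of 40 1680] in
        \<open>simp_all add: neg_not_square power_mult_distrib sq[unfolded that]\<close>)
  ultimately have "\<xi> = 1" using \<xi> by blast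
  then show ?thesis by (simp add: \<xi>_def)
qed

lemma points_over_quadratic_field:
  fixes x y z :: complex and K :: "complex set"
  assumes dep: "\<And>a b. a \<in> K \<Longrightarrow> b \<in> K \<Longrightarrow> a \<notin> \<rat> \<Longrightarrow> \<exists>c\<in>\<rat>. \<exists>d\<in>\<rat>. b = c * a + d"
    and K: "\<And>a b. a \<in> K \<Longrightarrow> b \<in> K \<Longrightarrow> a * b \<in> K" "\<And>a. a \<in> K \<Longrightarrow> inverse a \<in> K"
    and xyz: "x \<in> K" "y \<in> K" "z \<in> K"
    and y: "y ^ 2 = (5 * x ^ 2 - 1) * (x ^ 2 + 3)"
    and z: "z ^ 2 = - (3 * x ^ 2 + 1) * (x ^ 2 - 5)"
  shows "x \<in> {1, - 1}" "y \<in> {4, - 4}" "z \<in> {4, - 4}"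
proof -
  have x: "x ^ 2 = 1"
    using rational_square_coordinate[OF dep xyz y z] square_coordinate_rational[OF dep K xyz y z] by blast
  have "y ^ 2 = 4 ^ 2" "z ^ 2 = 4 ^ 2" unfolding y z x by simp_all
  then show "x \<in> {1, - 1}" "y \<in> {4, - 4}" "z \<in> {4, - 4}"
    using x unfolding power2_eq_iff power2_eq_1_iff by simp_all
qed

subsection \<open>Fields of degree at most two\<close>

lemma complex_field_simps [simp]:
  "carrier complex_field = UNIV" "x \<otimes>\<^bsub>complex_field\<^esub> y = x * y" "\<one>\<^bsub>complex_field\<^esub> = 1"
  "\<zero>\<^bsub>complex_field\<^esub> = 0" "x \<oplus>\<^bsub>complex_field\<^esub> y = x + y"
  by (simp_all add: ring_of_type_algebra_def)

lemma field_complex: "Ring.field complex_field"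
  by (rule field_from_type_algebra)

interpretation C: cring complex_field
  by (rule cring_from_type_algebra)

lemma complex_field_a_inv [simp]: "\<ominus>\<^bsub>complex_field\<^esub> x = - x"
  using C.minus_equality[of "- x" x] by simp

lemma complex_field_m_inv: "x \<noteq> 0 \<Longrightarrow> inv\<^bsub>complex_field\<^esub> x = inverse x"
  using C.comm_inv_char[of x "inverse x"] by simp

lemma Rats_subfield: "subfield \<rat> complex_field"
proof (rule field.subfieldI'[OF field_complex])
  show "subring \<rat> complex_field" by (rule C.subringI) auto
qed (auto simp: complex_field_m_inv)

lemma subfield_closed:
  assumes "subfield K complex_field"
  shows "\<And>a b. a \<in> K \<Longrightarrow> b \<in> K \<Longrightarrow> a + b \<in> K" "\<And>a b. a \<in> K \<Longrightarrow> b \<in> K \<Longrightarrow> a * b \<in> K"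
    "\<And>a. a \<in> K \<Longrightarrow> - a \<in> K" "\<And>a. a \<in> K \<Longrightarrow> inverse a \<in> K" "1 \<in> K" "0 \<in> K"
proof -
  note sub = subfieldE(1)[OF assms]
  show "a + b \<in> K" if "a \<in> K" "b \<in> K" for a b using subringE(7)[OF sub that] by simp
  show "a * b \<in> K" if "a \<in> K" "b \<in> K" for a b using subringE(6)[OF sub that] by simp
  show "- a \<in> K" if "a \<in> K" for a using subringE(5)[OF sub that] by simp
  show zero: "0 \<in> K" using subringE(2)[OF sub] by simp
  show "1 \<in> K" using subringE(3)[OF sub] by simp
  \<comment> \<open>The convention \<open>inverse 0 = 0\<close> makes this true at 0 as
    well.\<close>
  show "inverse a \<in> K" if "a \<in> K" for a
    using C.subfield_m_inv(1)[OF assms, of a] that zero complex_field_m_inv[of a] by (cases "a = 0") auto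
qed

lemma Rats_subset_subfield:
  assumes "subfield K complex_field"
  shows "\<rat> \<subseteq> K"
proof
  note closed = subfield_closed[OF assms]
  have nat: "of_nat n \<in> K" for n by (induction n) (auto intro: closed)
  have int: "of_int i \<in> K" for i
    by (cases i rule: int_cases2) (auto intro: closed nat)
  fix q :: complex assume "q \<in> \<rat>"
  then obtain r where "q = of_rat r" by (rule Rats_cases)
  moreover obtain a b where "r = Rat.Fract a b" by (cases r)
  ultimately have "q = of_int a * inverse (of_int b)"
    by (simp add: Fract_of_int_quotient of_rat_mult of_rat_inverse divide_inverse)
  then show "q \<in> K" by (simp add: closed int)
qed

section \<open>The field generated by a point and its degree\<close>

lemma point_field_rational:
  assumes "x \<in> \<rat>" "y \<in> \<rat>" "z \<in> \<rat>"
  shows "point_field (x, y, z) = \<rat>"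
proof
  show "point_field (x, y, z) \<subseteq> \<rat>"
    using field.generate_field_min_subfield1[OF field_complex _ Rats_subfield, of "{x, y, z}"] assms by simp
  show "\<rat> \<subseteq> point_field (x, y, z)"
    using Rats_subset_subfield field.generate_field_is_subfield[OF field_complex, of "{x, y, z}"] by simp
qed

lemma degree_at_most_rational:
  assumes "x \<in> \<rat>" "y \<in> \<rat>" "z \<in> \<rat>"
  shows "degree_at_most 2 (x, y, z)"
  unfolding degree_at_most_def point_field_rational[OF assms]
  using C.dimI[OF Rats_subfield C.dimension_one[OF Rats_subfield]]
    C.finite_dimensionI[OF C.dimension_one[OF Rats_subfield]]
  by (simp add: over_def)

text \<open>If \<open>b\<close> were not in the span of \<open>a\<close> and 1, then
  \<open>b\<close>, \<open>a\<close>, 1 would be three independent elements in dimension at most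
  2.\<close>

lemma dimension_two_dependence:
  assumes dim: "ring.dimension complex_field n \<rat> K" "n \<le> 2" and one: "1 \<in> K"
    and ab: "a \<in> K" "b \<in> K" "a \<notin> \<rat>"
  shows "\<exists>c\<in>\<rat>. \<exists>d\<in>\<rat>. b = c * a + d"
proof (rule ccontr)
  assume neg: "\<not> ?thesis"
  have Span1: "C.Span \<rat> [1] = \<rat>"
    by (auto simp: set_eq_iff C.line_extension_mem_iff)
  have Span2: "u \<in> C.Span \<rat> [a, 1] \<longleftrightarrow> (\<exists>c\<in>\<rat>. \<exists>d\<in>\<rat>. u = c * a + d)" for u
    using Span1 by (simp add: C.line_extension_mem_iff)
  have "C.independent \<rat> [b, a, 1]"
  proof (intro C.li_Cons)
    show "b \<notin> C.Span \<rat> [a, 1]" using neg Span2 by blast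
    show "a \<notin> C.Span \<rat> [1]" using ab Span1 by blast
  qed auto
  then have "length [b, a, 1] \<le> n"
    using C.independent_length_le_dimension[OF Rats_subfield dim(1), of "[b, a, 1]"] ab one by simp
  then show False using dim(2) by simp
qed

lemma Y_deg_2_subset: "Y_deg 2 \<subseteq> {1, -1} \<times> {4, -4} \<times> {4, -4}"
proof
  fix P assume P: "P \<in> Y_deg 2"
  obtain x y z where xyz: "P = (x, y, z)" by (cases P)
  define K where "K = point_field (x, y, z)"
  have "subfield K complex_field" unfolding K_def
    using field.generate_field_is_subfield[OF field_complex, of "{x, y, z}"] by simp
  note closed = subfield_closed[OF this]
  have fin: "C.finite_dimension \<rat> K" "C.dim \<rat> K \<le> 2"
    using P unfolding xyz Y_deg_def degree_at_most_def K_def by auto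
  \<comment> \<open>Finiteness ensures that the definite description \<open>C.dim\<close> denotes
    the actual dimension.\<close>
  have "C.dimension (C.dim \<rat> K) \<rat> K"
    using C.finite_dimensionE[OF Rats_subfield fin(1)] by (simp add: over_def)
  note dep = dimension_two_dependence[OF this fin(2) closed(5)]
  have mem: "x \<in> K" "y \<in> K" "z \<in> K" by (auto simp: K_def intro: generate_field.incl)
  have eqs: "y ^ 2 = (5 * x ^ 2 - 1) * (x ^ 2 + 3)" "z ^ 2 = - (3 * x ^ 2 + 1) * (x ^ 2 - 5)"
    using P unfolding xyz Y_deg_def Y_def by auto
  show "P \<in> {1, -1} \<times> {4, -4} \<times> {4, -4}"
    unfolding xyz using points_over_quadratic_field[OF dep closed(2,4) mem eqs] by (intro SigmaI)
qed

theorem theorem5p15: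
  shows "Y_deg 2 = Y \<rat> \<and> Y \<rat> = {1, -1} \<times> {4, -4} \<times> {4, -4}"
proof -
  have "Y \<rat> \<subseteq> Y_deg 2"
  proof
    fix P assume P: "P \<in> Y \<rat>"
    obtain x y z where xyz: "P = (x, y, z)" by (cases P)
    have rat: "x \<in> \<rat>" "y \<in> \<rat>" "z \<in> \<rat>" using P unfolding xyz Y_def by auto
    then have "x \<in> Qbar" "y \<in> Qbar" "z \<in> Qbar" by (auto intro: rat_imp_algebraic)
    then show "P \<in> Y_deg 2"
      using P degree_at_most_rational[OF rat] unfolding xyz Y_deg_def Y_def by simp
  qed
  moreover have "{1, -1} \<times> {4, -4} \<times> {4, -4} \<subseteq> Y \<rat>"
    unfolding Y_def by auto
  ultimately show ?thesis using Y_deg_2_subset by blast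
qed

end
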